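(* Let $C>1$ be a constant. There is a (sufficiently small) constant $c>0$ such that the following holds: if a randomized algorithm solves the $\ell_\infty$ regression problem up to a relative error of $c\sqrt d$, i.e., given any $A\in\mathbb R^{n\times d}$ and query access to any $b\in\mathbb R^n$ it outputs $\tilde x$ with $$\|A\tilde x-b\|_\infty\le c\sqrt d\,\min_{x\in\mathbb R^d}\|Ax-b\|_\infty$$ with probability at least $0.99$, and it queries $m$ entries of $b$ in expectation, then $m=\Omega(d^C)$.
   Context: Active regression: the design matrix $A$ is fully known to the algorithm, while each entry of $b$ read counts as one query. The lower bound is worst case over instances with $d$ columns ($n$ may depend on $d$ and $C$); $m$ is the worst-case expected number of queries. The constant in $\Omega(\cdot)$ may depend on $C$. *)

theory Defs
  imports "HOL-Probability.Probability" "Jordan_Normal_Form.Matrix"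
begin

unbundle no vec_syntax

definition linf_norm :: "real vec \<Rightarrow> real" where
  "linf_norm v = Max ((\<lambda>i. \<bar>v $ i\<bar>) ` {..<dim_vec v})"

definition regression_opt :: "real mat \<Rightarrow> real vec \<Rightarrow> real" where
  "regression_opt A b = (INF x\<in>carrier_vec (dim_col A). linf_norm (A *\<^sub>v x - b))"

text \<open>
  A deterministic adaptive query algorithm for a fixed design matrix is a decision tree:
  it either stops with an output vector, or reads one entry of \<open>b\<close> and continues depending on
  the real number it has seen.
\<close>

datatype qtree = Output "real vec" | Query nat "real \<Rightarrow> qtree"

primrec result :: "real vec \<Rightarrow> qtree \<Rightarrow> real vec" where
  "result b (Output x) = x"
| "result b (Query i f) = result b (f (b $ i))"

primrec queried :: "real vec \<Rightarrow> qtree \<Rightarrow> nat set" where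
  "queried b (Output x) = {}"
| "queried b (Query i f) = insert i (queried b (f (b $ i)))"

primrec valid_qtree :: "nat \<Rightarrow> nat \<Rightarrow> qtree \<Rightarrow> bool" where
  "valid_qtree n d (Output x) \<longleftrightarrow> x \<in> carrier_vec d"
| "valid_qtree n d (Query i f) \<longleftrightarrow> i < n \<and> (\<forall>y. valid_qtree n d (f y))"

text \<open>
  A randomized algorithm is a probability distribution over deterministic ones.  The sigma-algebra
  on trees is arbitrary; it is only required that, on every input, the output and the set of entries
  read are random variables.  An algorithm driven by a random seed from any probability space is
  covered: push the seed distribution forward to trees, with the final sigma-algebra.
\<close>

definition randomized_query_algorithm :: "nat \<Rightarrow> nat \<Rightarrow> qtree measure \<Rightarrow> bool" where
  "randomized_query_algorithm n d M \<longleftrightarrow>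
     prob_space M \<and>
     (\<forall>T\<in>space M. valid_qtree n d T) \<and>
     (\<forall>b\<in>carrier_vec n.
        (\<forall>j<d. (\<lambda>T. result b T $ j) \<in> borel_measurable M) \<and>
        queried b \<in> measurable M (count_space (Pow {..<n})))"

text \<open>
  The design matrix is known to the algorithm, so the distribution over trees may depend
  arbitrarily on it; access to \<open>b\<close> is through the tree only.
\<close>

definition solves_linf_regression ::
  "nat \<Rightarrow> real \<Rightarrow> (real mat \<Rightarrow> qtree measure) \<Rightarrow> bool" where
  "solves_linf_regression d \<kappa> alg \<longleftrightarrow>
     (\<forall>n>0. \<forall>A\<in>carrier_mat n d.
        randomized_query_algorithm n d (alg A) \<and>
        (\<forall>b\<in>carrier_vec n.
           measure (alg A)
             {T \<in> space (alg A). linf_norm (A *\<^sub>v result b T - b) \<le> \<kappa> * regression_opt A b}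
           \<ge> 0.99))"

definition expected_queries :: "qtree measure \<Rightarrow> real vec \<Rightarrow> ennreal" where
  "expected_queries M b = (\<integral>\<^sup>+ T. of_nat (card (queried b T)) \<partial>M)"

definition worst_case_queries :: "nat \<Rightarrow> (real mat \<Rightarrow> qtree measure) \<Rightarrow> ennreal" where
  "worst_case_queries d alg =
     (SUP n\<in>{0<..}. SUP A\<in>carrier_mat n d. SUP b\<in>carrier_vec n. expected_queries (alg A) b)"

end

theory Submission
  imports Defs "HOL-Algebra.Algebraic_Closure_Type" "HOL-Library.Z2"
begin

text \<open>
  Let \<open>q = 2 ^ r\<close> with \<open>q\<^sup>2 \<le> d < 4 q\<^sup>2\<close>. The graphs of the \<open>q ^ k\<close> polynomials of degree less
  than \<open>k\<close> over the field with \<open>q\<close> elements are \<open>q\<close>-element subsets of a \<open>d\<close>-element set, and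
  any two of them meet in fewer than \<open>k\<close> points. If the rows of \<open>A\<close> are their indicator vectors,
  then the \<open>i\<close>-th row divided by \<open>q\<close> shows that the optimum for the \<open>i\<close>-th unit vector is at
  most \<open>k / q \<le> 2 k / sqrt d\<close>. So for \<open>c < 1 / (2 k)\<close> an accurate output must distinguish each unit
  vector from \<open>b = 0\<close>, whose optimum is \<open>0\<close>; hence on input \<open>0\<close> every one of the \<open>q ^ k\<close> entries
  is read with probability at least \<open>0.98\<close>. Taking \<open>k \<ge> 2 C\<close> makes \<open>q ^ k\<close> of order \<open>d powr C\<close>
  or larger. The field consists of the roots of \<open>X\<^sup>q - X\<close> in the algebraic closure of the
  two-element field.
\<close>

no_notation fps_nth (infixl "$" 75)

hide_const (open) Polynomials.degree Divisibility.prime UnivPoly.up_ring.monom UnivPoly.up_ring.coeff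

section \<open>Finite fields as root sets in an algebraic closure\<close>

text \<open>Split off a linear factor, \<open>f = (X - a) g\<close>. The product rule gives
  \<open>f'(a) = g(a)\<close>, so \<open>a\<close> is not a root of \<open>g\<close>, and
  \<open>f'(x) = (x - a) g'(x)\<close> at a root \<open>x\<close> of \<open>g\<close>, so
  \<open>g\<close> inherits the absence of multiple roots. Each factor thus contributes one new
  root.\<close>

lemma card_roots_alg_closed:
  fixes f :: "'a :: alg_closed_field poly"
  assumes "f \<noteq> 0" and "\<And>x. poly f x = 0 \<Longrightarrow> poly (pderiv f) x \<noteq> 0"
  shows "card {x. poly f x = 0} = degree f"
  using assms
proof (induction "degree f" arbitrary: f)
  case 0
  then obtain a where "f = [:a:]" "a \<noteq> 0"
    by (metis degree_eq_zeroE pCons_0_0)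
  then show ?case by simp
next
  case (Suc n)
  then obtain a where a: "poly f a = 0"
    by (metis alg_closed_imp_poly_has_root zero_less_Suc)
  then obtain g where f: "f = [:-a, 1:] * g"
    by (metis dvdE poly_eq_0_iff_dvd)
  have "g \<noteq> 0" using Suc.prems f by auto
  then have deg: "degree f = Suc (degree g)"
    unfolding f by (subst degree_mult_eq) auto
  have deriv: "poly (pderiv f) x = poly g x + (x - a) * poly (pderiv g) x" for x
    unfolding f by (simp only: pderiv_mult poly_add poly_mult) (simp add: pderiv_pCons algebra_simps)
  have ga: "poly g a \<noteq> 0"
    using Suc.prems(2)[OF a] by (simp add: deriv)
  have "poly (pderiv g) x \<noteq> 0" if "poly g x = 0" for x
  proof -
    have "poly f x = 0" using that by (simp add: f)
    then show ?thesis using Suc.prems(2)[of x] that by (simp add: deriv)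
  qed
  then have "card {x. poly g x = 0} = degree g"
    using Suc.hyps \<open>g \<noteq> 0\<close> deg by simp
  moreover have "{x. poly f x = 0} = insert a {x. poly g x = 0}"
    by (auto simp: f)
  ultimately show ?case
    using ga deg poly_roots_finite[OF \<open>g \<noteq> 0\<close>] by simp
qed

text \<open>The roots of \<open>X^q - X\<close> are simple, as its derivative is \<open>-1\<close>,
  so there are exactly \<open>q = p ^ r\<close> of them. Closure under addition is the additivity of
  the Frobenius power \<open>x ^ q\<close>.\<close>

lemma finite_subring_of_prime_power_card:
  fixes p r :: nat
  assumes p: "prime p" "CHAR('a :: alg_closed_field) = p" and r: "r > 0"
  obtains F :: "'a :: alg_closed_field set" where "finite F" "card F = p ^ r" "0 \<in> F" "1 \<in> F"
    "\<And>x y. x \<in> F \<Longrightarrow> y \<in> F \<Longrightarrow> x + y \<in> F" "\<And>x y. x \<in> F \<Longrightarrow> y \<in> F \<Longrightarrow> x * y \<in> F"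
proof
  define q where "q = p ^ r"
  have q: "q > 1" unfolding q_def
    using p r by (metis one_less_power prime_gt_1_nat)
  define f :: "'a poly" where "f = monom 1 q - monom 1 1"
  \<comment> \<open>Since \<open>r > 0\<close>, the characteristic \<open>p\<close> divides
    \<open>q\<close>, which kills the leading term of the derivative.\<close>
  have "of_nat q = (0 :: 'a)"
    using p r by (simp add: q_def of_nat_eq_0_iff_char_dvd dvd_power)
  then have deriv: "pderiv f = - 1"
    by (simp add: f_def pderiv_diff pderiv_monom monom_0 one_pCons)
  have deg: "degree f = q"
    using q unfolding f_def diff_conv_add_uminus
    by (subst degree_add_eq_left) (auto simp: degree_monom_eq)
  have "f \<noteq> 0" using deg q by auto
  have F: "{x. poly f x = 0} = {x. x ^ q = x}"
    by (simp add: f_def poly_monom)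
  show "finite {x :: 'a. x ^ q = x}"
    using poly_roots_finite[OF \<open>f \<noteq> 0\<close>] F by simp
  show "card {x :: 'a. x ^ q = x} = p ^ r"
    using card_roots_alg_closed[OF \<open>f \<noteq> 0\<close>] by (simp add: F deriv deg q_def)
  show "0 \<in> {x :: 'a. x ^ q = x}" "1 \<in> {x :: 'a. x ^ q = x}"
    using q by auto
  fix x y :: 'a
  assume "x \<in> {x. x ^ q = x}" "y \<in> {x. x ^ q = x}"
  then show "x + y \<in> {x. x ^ q = x}" "x * y \<in> {x. x ^ q = x}"
    using freshmans_dream'[of q r x y] p by (auto simp: q_def power_mult_distrib)
qed

lemma CHAR_bit: "CHAR(bit) = 2"
  by (rule CHAR_eq_posI) (auto simp: less_2_cases_iff)

section \<open>Large set families with small pairwise intersections\<close>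

text \<open>This is the Reed-Solomon construction: the difference of two distinct polynomials of
  degree below \<open>k\<close> has fewer than \<open>k\<close> roots, so their graphs share fewer
  than \<open>k\<close> points.\<close>

lemma set_family_small_intersections:
  fixes q r k d :: nat
  assumes q: "q = 2 ^ r" "r > 0" and d: "q\<^sup>2 \<le> d" and k: "k > 0"
  obtains S :: "nat \<Rightarrow> nat set" where
    "\<And>i. i < q ^ k \<Longrightarrow> S i \<subseteq> {..<d}" "\<And>i. i < q ^ k \<Longrightarrow> card (S i) = q"
    "\<And>i j. i < q ^ k \<Longrightarrow> j < q ^ k \<Longrightarrow> i \<noteq> j \<Longrightarrow> card (S i \<inter> S j) < k"
proof -
  have char: "CHAR(bit alg_closure) = 2" by (simp add: CHAR_bit)
  obtain F :: "bit alg_closure set" where F: "finite F" "card F = 2 ^ r" "0 \<in> F" "1 \<in> F"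
    and add: "\<And>x y. x \<in> F \<Longrightarrow> y \<in> F \<Longrightarrow> x + y \<in> F"
    and mult: "\<And>x y. x \<in> F \<Longrightarrow> y \<in> F \<Longrightarrow> x * y \<in> F"
    using finite_subring_of_prime_power_card[OF two_is_prime_nat char q(2)] by blast
  have cardF: "card F = q" using F q by simp
  define P where "P = {..<k} \<rightarrow>\<^sub>E F"
  define ev where "ev c x = (\<Sum>j<k. c j * x ^ j)" for c and x :: "bit alg_closure"
  have pow: "x ^ j \<in> F" if "x \<in> F" for x j
    by (induction j) (use F mult that in auto)
  have evF: "ev c x \<in> F" if "c \<in> P" "x \<in> F" for c x
  proof -
    have "sum (\<lambda>j. c j * x ^ j) J \<in> F" if "finite J" "J \<subseteq> {..<k}" for J
      using that
    proof (induction J)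
      case (insert j J)
      then have "c j \<in> F" using \<open>c \<in> P\<close> by (auto simp: P_def)
      with insert show ?case using \<open>x \<in> F\<close> by (auto intro!: add mult pow)
    qed (use F in auto)
    then show ?thesis unfolding ev_def by auto
  qed
  have agree: "card {x \<in> F. ev c x = ev c' x} < k" if c: "c \<in> P" "c' \<in> P" "c \<noteq> c'" for c c'
  proof -
    define f where "f = (\<Sum>j<k. monom (c j - c' j) j)"
    \<comment> \<open>Members of \<open>P\<close> are \<open>undefined\<close> outside
      \<open>{..<k}\<close>, so distinct ones differ at an index below \<open>k\<close>.\<close>
    obtain j where j: "j < k" "c j \<noteq> c' j"
      using c unfolding P_def by (metis PiE_ext lessThan_iff)
    have coeff: "coeff f i = (if i < k then c i - c' i else 0)" for i
      by (simp add: f_def coeff_sum sum.delta)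
    have "f \<noteq> 0" using coeff[of j] j by auto
    have "degree f < k"
      using k coeff by (intro degree_lessI) auto
    have "poly f x = ev c x - ev c' x" for x
      by (simp add: f_def ev_def poly_sum poly_monom sum_subtractf algebra_simps)
    then have "{x \<in> F. ev c x = ev c' x} \<subseteq> {x. poly f x = 0}" by auto
    then have "card {x \<in> F. ev c x = ev c' x} \<le> degree f"
      using card_poly_roots_bound[OF \<open>f \<noteq> 0\<close>]
      by (rule le_trans[OF card_mono[OF poly_roots_finite[OF \<open>f \<noteq> 0\<close>]]])
    with \<open>degree f < k\<close> show ?thesis by simp
  qed
  have "card (F \<times> F) \<le> card {..<d}"
    using cardF d by (simp add: card_cartesian_product power2_eq_square)
  \<comment> \<open>The injection \<open>e\<close> turns points of the plane over \<open>F\<close>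
    into column indices; \<open>q\<^sup>2 \<le> d\<close> leaves room for it.\<close>
  then obtain e where e: "e ` (F \<times> F) \<subseteq> {..<d}" "inj_on e (F \<times> F)"
    using F card_le_inj[of "F \<times> F" "{..<d}"] by auto
  have "finite P" unfolding P_def by (rule finite_PiE) (use F in auto)
  have "card P = q ^ k" unfolding P_def by (simp add: card_funcsetE cardF)
  with \<open>finite P\<close> obtain h where h: "bij_betw h {..<q ^ k} P"
    using ex_bij_betw_nat_finite[of P] by (auto simp: atLeast0LessThan)
  define G where "G c = (\<lambda>x. (x, ev c x)) ` F" for c
  have GF: "G c \<subseteq> F \<times> F" if "c \<in> P" for c
    using evF that by (auto simp: G_def)
  have hP: "h i \<in> P" if "i < q ^ k" for i
    using h that by (auto simp: bij_betw_def)
  show thesis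
  proof (rule that[of "\<lambda>i. e ` G (h i)"])
    fix i assume i: "i < q ^ k"
    show "e ` G (h i) \<subseteq> {..<d}" using GF[OF hP[OF i]] e by blast
    have "card (e ` G (h i)) = card (G (h i))"
      using e GF[OF hP[OF i]] by (intro card_image) (rule inj_on_subset)
    also have "\<dots> = q"
      unfolding G_def using cardF by (subst card_image) (auto intro: inj_onI)
    finally show "card (e ` G (h i)) = q" .
  next
    fix i j assume ij: "i < q ^ k" "j < q ^ k" "i \<noteq> j"
    have "e ` G (h i) \<inter> e ` G (h j) = e ` (G (h i) \<inter> G (h j))"
      using inj_on_image_Int[OF e(2) GF[OF hP] GF[OF hP]] ij by simp
    also have "card \<dots> \<le> card (G (h i) \<inter> G (h j))"
      using F by (intro card_image_le) (auto simp: G_def)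
    also have "G (h i) \<inter> G (h j) = (\<lambda>x. (x, ev (h i) x)) ` {x \<in> F. ev (h i) x = ev (h j) x}"
      by (auto simp: G_def)
    also have "card \<dots> \<le> card {x \<in> F. ev (h i) x = ev (h j) x}"
      using F by (intro card_image_le) auto
    also have "\<dots> < k"
      using h ij by (intro agree hP) (auto simp: bij_betw_def inj_on_def)
    finally show "card (e ` G (h i) \<inter> e ` G (h j)) < k" .
  qed
qed

section \<open>Query trees, the maximum norm and the optimum\<close>

lemma result_cong:
  assumes "\<And>i. i \<in> queried b T \<Longrightarrow> b $ i = b' $ i"
  shows "result b' T = result b T"
  using assms by (induction T) auto

lemma abs_index_le_linf_norm:
  assumes "i < dim_vec v"
  shows "\<bar>v $ i\<bar> \<le> linf_norm v"
  unfolding linf_norm_def using assms by (intro Max_ge) auto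

lemma linf_norm_leI:
  assumes "dim_vec v > 0" and "\<And>i. i < dim_vec v \<Longrightarrow> \<bar>v $ i\<bar> \<le> c"
  shows "linf_norm v \<le> c"
  unfolding linf_norm_def using assms by (intro Max.boundedI) auto

lemma regression_opt_le:
  assumes "dim_vec b > 0" and "x \<in> carrier_vec (dim_col A)"
  shows "regression_opt A b \<le> linf_norm (A *\<^sub>v x - b)"
  unfolding regression_opt_def
proof (rule cINF_lower[OF _ assms(2)], rule bdd_belowI2)
  fix y
  show "0 \<le> linf_norm (A *\<^sub>v y - b)"
    \<comment> \<open>Entry 0 exists because \<open>b\<close> is nonempty, and it bounds the norm
      below by 0.\<close>
    using abs_index_le_linf_norm[of 0 "A *\<^sub>v y - b"] assms by simp
qed

section \<open>Optima for the incidence matrix of a set family\<close>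

lemma mult_mat_vec_indicators:
  fixes S :: "nat \<Rightarrow> nat set"
  assumes "i < n" and "S i \<subseteq> {..<d}"
  shows "(mat n d (\<lambda>(i, j). of_bool (j \<in> S i)) *\<^sub>v vec d (\<lambda>j. of_bool (j \<in> R) * a)) $ i
    = real (card (S i \<inter> R)) * a"
proof -
  have "(mat n d (\<lambda>(i, j). of_bool (j \<in> S i)) *\<^sub>v vec d (\<lambda>j. of_bool (j \<in> R) * a)) $ i
    = (\<Sum>j<d. of_bool (j \<in> S i) * (of_bool (j \<in> R) * a))"
    using assms(1) by (simp add: scalar_prod_def lessThan_atLeast0)
  also have "\<dots> = (\<Sum>j<d. of_bool (j \<in> S i \<inter> R) * a)"
    by (intro sum.cong) auto
  also have "\<dots> = (\<Sum>j\<in>S i \<inter> R. a)"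
    using assms(2) by (intro sum.mono_neutral_cong_right) auto
  finally show ?thesis by simp
qed

text \<open>For the scaled \<open>i\<close>-th row as \<open>x\<close>, the residual vanishes at
  \<open>i\<close>, where \<open>card (S i) / q = 1\<close>, and elsewhere it is an intersection
  size divided by \<open>q\<close>.\<close>

lemma regression_opt_unit_vec_le:
  fixes S :: "nat \<Rightarrow> nat set" and k q :: nat
  assumes i: "i < n" and q: "q > 0" and sub: "\<And>i. i < n \<Longrightarrow> S i \<subseteq> {..<d}"
    and card: "card (S i) = q" and "\<And>j. j < n \<Longrightarrow> j \<noteq> i \<Longrightarrow> card (S j \<inter> S i) < k"
  shows "regression_opt (mat n d (\<lambda>(i, j). of_bool (j \<in> S i))) (unit_vec n i) \<le> real k / real q"
proof -
  let ?A = "mat n d (\<lambda>(i, j). of_bool (j \<in> S i)) :: real mat"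
  let ?x = "vec d (\<lambda>j. of_bool (j \<in> S i) * (1 / real q))"
  have "regression_opt ?A (unit_vec n i) \<le> linf_norm (?A *\<^sub>v ?x - unit_vec n i)"
    using i by (intro regression_opt_le) auto
  also have "\<dots> \<le> real k / real q"
  proof (rule linf_norm_leI)
    fix j assume "j < dim_vec (?A *\<^sub>v ?x - unit_vec n i)"
    then have j: "j < n" by simp
    have *: "(?A *\<^sub>v ?x) $ j = real (card (S j \<inter> S i)) * (1 / real q)"
      by (intro mult_mat_vec_indicators j sub)
    show "\<bar>(?A *\<^sub>v ?x - unit_vec n i) $ j\<bar> \<le> real k / real q"
    proof (cases "j = i")
      case True
      have "(?A *\<^sub>v ?x) $ j = 1" using * True card q by simp
      with True i show ?thesis by simp
    next
      case False
      have "(?A *\<^sub>v ?x - unit_vec n i) $ j = real (card (S j \<inter> S i)) / real q"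
        using * j i False by simp
      moreover have "card (S j \<inter> S i) \<le> k" using assms j False by (simp add: less_imp_le)
      ultimately show ?thesis by (simp add: divide_right_mono)
    qed
  qed (use i in auto)
  finally show ?thesis .
qed

lemma regression_opt_zero_le:
  assumes "n > 0" and "A \<in> carrier_mat n d"
  shows "regression_opt A (0\<^sub>v n) \<le> 0"
proof -
  have "regression_opt A (0\<^sub>v n) \<le> linf_norm (A *\<^sub>v 0\<^sub>v d - 0\<^sub>v n)"
    using assms by (intro regression_opt_le) auto
  also have "\<dots> \<le> 0"
    using assms by (intro linf_norm_leI) (auto simp: scalar_prod_def)
  finally show ?thesis .
qed

section \<open>From correctness probabilities to expected queries\<close>

text \<open>Linearity of expectation: the number of entries read is the sum of the indicators of the
  events \<open>Q i\<close>.\<close>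

lemma expected_queries_ge:
  assumes alg: "randomized_query_algorithm n d M" and b: "b \<in> carrier_vec n"
    and prob: "\<And>i. i < n \<Longrightarrow> measure M {T \<in> space M. i \<in> queried b T} \<ge> \<delta>"
  shows "expected_queries M b \<ge> ennreal (real n * \<delta>)"
proof -
  interpret prob_space M using alg by (simp add: randomized_query_algorithm_def)
  have meas: "queried b \<in> measurable M (count_space (Pow {..<n}))"
    using alg b by (simp add: randomized_query_algorithm_def)
  define Q where "Q i = {T \<in> space M. i \<in> queried b T}" for i
  have Q: "Q i \<in> sets M" for i
  proof -
    have "Q i = queried b -` {I \<in> Pow {..<n}. i \<in> I} \<inter> space M"
      using measurable_space[OF meas] by (auto simp: Q_def)
    also have "\<dots> \<in> sets M" by (rule measurable_sets[OF meas]) auto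
    finally show ?thesis .
  qed
  have card: "of_nat (card (queried b T)) = (\<Sum>i<n. indicator (Q i) T :: ennreal)"
    if "T \<in> space M" for T
  proof -
    have "queried b T \<subseteq> {..<n}" using measurable_space[OF meas that] by simp
    then have "card (queried b T) = (\<Sum>i<n. of_bool (i \<in> queried b T))"
      by (simp add: sum.If_cases of_bool_def Int_absorb1 Int_commute)
    then show ?thesis
      using that by (auto simp: Q_def indicator_def of_bool_def intro!: sum.cong)
  qed
  have "ennreal (real n * \<delta>) = (\<Sum>i<n. ennreal \<delta>)"
    by (simp add: ennreal_mult' ennreal_of_nat_eq_real_of_nat)
  also have "\<dots> \<le> (\<Sum>i<n. emeasure M (Q i))"
    using prob by (intro sum_mono) (simp add: emeasure_eq_measure Q_def ennreal_leI)
  also have "\<dots> = (\<integral>\<^sup>+ T. (\<Sum>i<n. indicator (Q i) T) \<partial>M)"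
    using Q by (subst nn_integral_sum) auto
  also have "\<dots> = expected_queries M b"
    unfolding expected_queries_def by (intro nn_integral_cong) (simp add: card)
  finally show ?thesis .
qed

text \<open>
  On input \<open>0\<close> a correct output \<open>x\<close> satisfies \<open>A x = 0\<close>, which is wrong for the
  \<open>i\<close>-th unit vector; so a tree that is correct on both inputs must read entry \<open>i\<close>.
\<close>

lemma queried_zero_if_both_correct:
  assumes A: "A \<in> carrier_mat n d" and i: "i < n" and \<kappa>: "\<kappa> \<ge> 0"
    and opt: "\<kappa> * regression_opt A (unit_vec n i) < 1"
    and zero: "linf_norm (A *\<^sub>v result (0\<^sub>v n) T - 0\<^sub>v n) \<le> \<kappa> * regression_opt A (0\<^sub>v n)"
    and unit: "linf_norm (A *\<^sub>v result (unit_vec n i) T - unit_vec n i)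
      \<le> \<kappa> * regression_opt A (unit_vec n i)"
    and bounded: "queried (0\<^sub>v n) T \<subseteq> {..<n}"
  shows "i \<in> queried (0\<^sub>v n) T"
proof (rule ccontr)
  assume "i \<notin> queried (0\<^sub>v n) T"
  \<comment> \<open>The two inputs differ only at \<open>i\<close>, so the tree takes the same path
    on both.\<close>
  then have eq: "result (unit_vec n i) T = result (0\<^sub>v n) T"
    using bounded i by (intro result_cong) (auto simp: unit_vec_def)
  have "\<kappa> * regression_opt A (0\<^sub>v n) \<le> 0"
    using regression_opt_zero_le[OF _ A] i \<kappa> by (simp add: mult_nonneg_nonpos)
  then have "linf_norm (A *\<^sub>v result (0\<^sub>v n) T - 0\<^sub>v n) \<le> 0"
    using zero by simp
  moreover have "\<bar>(A *\<^sub>v result (0\<^sub>v n) T - 0\<^sub>v n) $ i\<bar> \<le> linf_norm (A *\<^sub>v result (0\<^sub>v n) T - 0\<^sub>v n)"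
    using A i by (intro abs_index_le_linf_norm) auto
  ultimately have "(A *\<^sub>v result (0\<^sub>v n) T) $ i = 0"
    using A i by auto
  \<comment> \<open>With \<open>(A x) $ i = 0\<close> this entry would be \<open>-1\<close>, a
    contradiction.\<close>
  moreover have "\<bar>(A *\<^sub>v result (0\<^sub>v n) T - unit_vec n i) $ i\<bar> < 1"
    using abs_index_le_linf_norm[of i "A *\<^sub>v result (0\<^sub>v n) T - unit_vec n i"] A i unit opt
    unfolding eq by auto
  ultimately show False
    using A i by auto
qed

lemma worst_case_queries_ge:
  assumes solves: "solves_linf_regression d \<kappa> alg"
    and A: "A \<in> carrier_mat n d" and n: "n > 0" and \<kappa>: "\<kappa> \<ge> 0"
    and opt: "\<And>i. i < n \<Longrightarrow> \<kappa> * regression_opt A (unit_vec n i) < 1"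
  shows "worst_case_queries d alg \<ge> ennreal (real n * 0.98)"
proof -
  define good where
    "good b = {T \<in> space (alg A). linf_norm (A *\<^sub>v result b T - b) \<le> \<kappa> * regression_opt A b}" for b
  have alg: "randomized_query_algorithm n d (alg A)"
    and prob: "\<And>b. b \<in> carrier_vec n \<Longrightarrow> measure (alg A) (good b) \<ge> 0.99"
    using solves A n by (auto simp: solves_linf_regression_def good_def)
  interpret prob_space "alg A" using alg by (simp add: randomized_query_algorithm_def)
  have meas: "queried (0\<^sub>v n) \<in> measurable (alg A) (count_space (Pow {..<n}))"
    using alg by (simp add: randomized_query_algorithm_def)
  \<comment> \<open>Non-measurable sets have \<open>measure\<close> zero, so a positive value gives measurability.\<close>
  have good: "good b \<in> sets (alg A)" if "b \<in> carrier_vec n" for b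
    using prob[OF that] measure_notin_sets[of "good b" "alg A"] by fastforce
  have "measure (alg A) {T \<in> space (alg A). i \<in> queried (0\<^sub>v n) T} \<ge> 0.98" if i: "i < n" for i
  proof -
    let ?Q = "{T \<in> space (alg A). i \<in> queried (0\<^sub>v n) T}"
    let ?G = "good (0\<^sub>v n)" and ?G' = "good (unit_vec n i)"
    have sets: "?G \<in> events" "?G' \<in> events" by (auto intro: good)
    have "?Q = queried (0\<^sub>v n) -` {I \<in> Pow {..<n}. i \<in> I} \<inter> space (alg A)"
      using measurable_space[OF meas] by auto
    also have "\<dots> \<in> events" by (rule measurable_sets[OF meas]) auto
    finally have Q: "?Q \<in> events" .
    have "?G \<inter> ?G' \<subseteq> ?Q"
      using queried_zero_if_both_correct[OF A i \<kappa> opt[OF i]] measurable_space[OF meas]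
      by (auto simp: good_def)
    then have "prob (?G \<inter> ?G') \<le> prob ?Q"
      using Q by (rule finite_measure_mono)
    \<comment> \<open>Inclusion-exclusion leaves the intersection at least
      \<open>0.99 + 0.99 - 1 = 0.98\<close>.\<close>
    moreover have "prob (?G \<union> ?G') = prob ?G + prob ?G' - prob (?G \<inter> ?G')"
      using sets by (simp add: measure_Un3 fmeasurable_eq_sets)
    moreover have "prob (?G \<union> ?G') \<le> 1" by simp
    moreover have "prob ?G \<ge> 99 / 100" "prob ?G' \<ge> 99 / 100"
      using prob[of "0\<^sub>v n"] prob[of "unit_vec n i"] by auto
    ultimately have "prob ?Q \<ge> 98 / 100" by linarith
    then show ?thesis by simp
  qed
  then have "ennreal (real n * 0.98) \<le> expected_queries (alg A) (0\<^sub>v n)"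
    using alg by (intro expected_queries_ge) auto
  also have "\<dots> \<le> worst_case_queries d alg"
    unfolding worst_case_queries_def
    by (rule SUP_upper2[of n], use n in simp, rule SUP_upper2[OF A], rule SUP_upper) simp
  finally show ?thesis .
qed

section \<open>Choice of parameters and the final bound\<close>

lemma power_of_two_near_sqrt:
  assumes "d \<ge> (4::nat)"
  obtains r where "r > 0" "((2::nat) ^ r)\<^sup>2 \<le> d" "d < 4 * (2 ^ r)\<^sup>2"
proof -
  \<comment> \<open>Here \<open>4 ^ r\<close> is the largest power of 4 up to \<open>d\<close>;
    \<open>d \<ge> 4\<close> excludes \<open>r = 0\<close>.\<close>
  obtain r where r: "4 ^ r \<le> d" "d < 4 ^ Suc r"
    using ex_power_ivl1[of 4 d] assms by auto
  have four: "((2::nat) ^ r)\<^sup>2 = 4 ^ r" 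
  proof -
    have "((2::nat) ^ r)\<^sup>2 = (2\<^sup>2) ^ r" by (simp only: power_mult [symmetric] mult.commute)
    then show ?thesis by simp
  qed
  have "r > 0" using r assms by (cases r) auto
  then show thesis using that r four by simp
qed

theorem theorem14p4:
  fixes C :: real
  assumes "C > 1"
  shows "\<exists>c>0. \<exists>K>0. \<exists>d0::nat. \<forall>d\<ge>d0. \<forall>alg :: real mat \<Rightarrow> qtree measure.
           solves_linf_regression d (c * sqrt (real d)) alg \<longrightarrow>
           worst_case_queries d alg \<ge> ennreal (K * real d powr C)"
proof -
  define k where "k = nat \<lceil>2 * C\<rceil>"
  have k: "real k \<ge> 2 * C" "k > 0" using assms by (auto simp: k_def)
  \<comment> \<open>As \<open>sqrt d < 2 q\<close>, this makes \<open>c * sqrt d * (k / q)\<close>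
    at most \<open>1 / 2\<close>, safely below 1.\<close>
  define c where "c = 1 / (4 * real k)"
  \<comment> \<open>The factor \<open>2 ^ k\<close> pays for rounding \<open>sqrt d\<close> down to
    a power of two: \<open>d powr C \<le> (2 q) ^ k = 2 ^ k * n\<close>.\<close>
  define K :: real where "K = 0.98 / 2 ^ k"
  have "worst_case_queries d alg \<ge> ennreal (K * real d powr C)"
    if d: "d \<ge> 4" and solves: "solves_linf_regression d (c * sqrt (real d)) alg" for d alg
  proof -
    obtain r where r: "r > 0" "((2::nat) ^ r)\<^sup>2 \<le> d" "d < 4 * (2 ^ r)\<^sup>2"
      using power_of_two_near_sqrt[OF d] .
    define q :: nat where "q = 2 ^ r"
    define n where "n = q ^ k"
    have q: "q > 0" "n > 0" by (auto simp: q_def n_def)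
    have "real d < real (4 * (2 ^ r)\<^sup>2)"
      using r(3) by (simp only: of_nat_less_iff)
    then have "real d < (2 * real q)\<^sup>2"
      by (simp add: q_def power_mult_distrib)
    then have sqrt: "sqrt (real d) < 2 * real q"
      by (intro real_less_lsqrt) auto
    obtain S where S: "\<And>i. i < n \<Longrightarrow> S i \<subseteq> {..<d}" "\<And>i. i < n \<Longrightarrow> card (S i) = q"
      "\<And>i j. i < n \<Longrightarrow> j < n \<Longrightarrow> i \<noteq> j \<Longrightarrow> card (S i \<inter> S j) < k"
      using set_family_small_intersections[of q r d k] r k unfolding q_def n_def by metis
    define A :: "real mat" where "A = mat n d (\<lambda>(i, j). of_bool (j \<in> S i))"
    have "c * sqrt (real d) * regression_opt A (unit_vec n i) < 1" if "i < n" for i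
    proof -
      have "c * sqrt (real d) * regression_opt A (unit_vec n i) \<le> c * sqrt (real d) * (real k / real q)"
        unfolding A_def using S q that k
        by (intro mult_left_mono regression_opt_unit_vec_le) (auto simp: c_def)
      also have "\<dots> \<le> c * (2 * real q) * (real k / real q)"
        using sqrt by (intro mult_right_mono mult_left_mono) (auto simp: c_def)
      also have "\<dots> = 1 / 2" using k(2) q(1) by (simp add: c_def)
      also have "\<dots> < (1 :: real)" by simp
      finally show ?thesis .
    qed
    then have queries: "ennreal (real n * 0.98) \<le> worst_case_queries d alg"
      using q by (intro worst_case_queries_ge[OF solves, of A]) (auto simp: A_def c_def)
    have size: "K * real d powr C \<le> real n * 0.98"
    proof -
      have "real d powr C \<le> real d powr (real k / 2)"
        using k d by (intro powr_mono) auto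
      also have "\<dots> = (real d powr (1 / 2)) powr real k"
        by (simp add: powr_powr)
      also have "\<dots> = sqrt (real d) ^ k"
        using d by (simp add: powr_half_sqrt powr_realpow)
      also have "\<dots> \<le> (2 * real q) ^ k"
        using sqrt by (intro power_mono) auto
      finally have "K * real d powr C \<le> K * (2 * real q) ^ k"
        by (intro mult_left_mono) (auto simp: K_def)
      also have "\<dots> = real n * 0.98"
        by (simp add: K_def n_def power_mult_distrib)
      finally show ?thesis .
    qed
    show ?thesis
      using ennreal_leI[OF size] queries by (rule order_trans)
  qed
  moreover have "c > 0" "K > 0" using k by (auto simp: c_def K_def)
  ultimately show ?thesis
    by (intro exI[of _ c] exI[of _ K] exI[of _ 4] conjI allI impI)
qed

end
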